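(* Let $d\ge 2$ and suppose that a smooth hypersurface in $\mathbb{R}^d$ is moving in the velocity field $V(x,t)$. Let $\sigma$ denote the surface element area and $n$ the unit normal vector at a point of the surface. Then the surface stretch rate is given by $$\frac{1}{\sigma}\frac{d\sigma}{dt}=\mathrm{div}(V)-n\cdot DV\cdot n,$$ where the right-hand side is evaluated at the current position of the point at time $t$.
   Context: $V:\mathbb{R}^d\times\mathbb{R}\to\mathbb{R}^d$ is a smooth time-dependent vector field. $DV$ is the spatial Jacobian matrix, $(DV)_{ij}=\partial V_i/\partial x_j$; $\mathrm{div}(V)=\sum_i\partial V_i/\partial x_i$ is the spatial divergence; and $n\cdot DV\cdot n=n^T(DV)n=\sum_{i,j}n_i\,(\partial V_i/\partial x_j)\,n_j$. "The hypersurface moves in the velocity field $V$" means that each point $x(t)$ of the surface follows $\frac{dx}{dt}=V(x(t),t)$. Concretely, the surface at time $t$ is locally parametrized by a smooth immersion $\theta\mapsto X(\theta,t)$, with $\theta$ in an open subset of $\mathbb{R}^{d-1}$ and $\partial_tX(\theta,t)=V(X(\theta,t),t)$. The surface element area at the point labelled $\theta$ is the $(d-1)$-dimensional area of the infinitesimal surface element carried along by the motion, i.e. $\sigma(\theta,t)=\sqrt{\det\big((\partial_\theta X)^T\partial_\theta X\big)}$, where $\partial_\theta X$ is the $d\times(d-1)$ Jacobian matrix in $\theta$. The surface stretch rate is $\frac1\sigma\frac{d\sigma}{dt}$ with $\theta$ held fixed (i.e. following the moving point); it does not depend on the choice of parametrization. The vector $n$ is a unit vector orthogonal to the tangent space of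 the surface at $X(\theta,t)$. *)

theory Defs
  imports "HOL-Analysis.Analysis"
begin

text \<open>Smooth means \<open>C\<^sup>\<infinity>\<close> on an open set: \<open>f\<close> and all its iterated directional derivatives are
  differentiable.\<close>

fun Ck_on :: "nat \<Rightarrow> 'a::real_normed_vector set \<Rightarrow> ('a \<Rightarrow> 'b::real_normed_vector) \<Rightarrow> bool" where
  "Ck_on 0 S f \<longleftrightarrow> continuous_on S f"
| "Ck_on (Suc k) S f \<longleftrightarrow>
     (\<forall>x\<in>S. f differentiable at x) \<and>
     (\<forall>v. Ck_on k S (\<lambda>x. frechet_derivative f (at x) v))"

definition smooth_on :: "'a::real_normed_vector set \<Rightarrow> ('a \<Rightarrow> 'b::real_normed_vector) \<Rightarrow> bool" where
  "smooth_on S f \<longleftrightarrow> open S \<and> (\<forall>k. Ck_on k S f)"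

definition immersion_on :: "(real^'m) set \<Rightarrow> (real^'m \<Rightarrow> real^'n) \<Rightarrow> bool" where
  "immersion_on U f \<longleftrightarrow> smooth_on U f \<and> (\<forall>\<theta>\<in>U. inj (frechet_derivative f (at \<theta>)))"

text \<open>A patch \<open>X \<theta> t\<close>, with label \<open>\<theta> \<in> U\<close> and time \<open>t \<in> T\<close>, of a hypersurface moving in the
  velocity field \<open>V\<close>. Smoothness of \<open>X\<close> is required in \<open>\<theta>\<close> only, for each fixed time.\<close>

definition moving_hypersurface ::
  "(real^'n \<Rightarrow> real \<Rightarrow> real^'n) \<Rightarrow> (real^'m) set \<Rightarrow> real set \<Rightarrow> (real^'m \<Rightarrow> real \<Rightarrow> real^'n) \<Rightarrow> bool" where
  "moving_hypersurface V U T X \<longleftrightarrow>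
     CARD('m) = CARD('n) - 1 \<and> open U \<and> open T \<and>
     (\<forall>t\<in>T. immersion_on U (\<lambda>\<theta>. X \<theta> t)) \<and>
     (\<forall>\<theta>\<in>U. \<forall>t\<in>T. (X \<theta> has_vector_derivative V (X \<theta> t) t) (at t))"

definition tangent_space :: "(real^'m \<Rightarrow> real \<Rightarrow> real^'n) \<Rightarrow> real^'m \<Rightarrow> real \<Rightarrow> (real^'n) set" where
  "tangent_space X \<theta> t = range (frechet_derivative (\<lambda>\<eta>. X \<eta> t) (at \<theta>))"

definition unit_normal :: "(real^'m \<Rightarrow> real \<Rightarrow> real^'n) \<Rightarrow> real^'m \<Rightarrow> real \<Rightarrow> real^'n \<Rightarrow> bool" where
  "unit_normal X \<theta> t n \<longleftrightarrow> norm n = 1 \<and> (\<forall>v\<in>tangent_space X \<theta> t. orthogonal n v)"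

definition area_element :: "(real^'m \<Rightarrow> real \<Rightarrow> real^'n) \<Rightarrow> real^'m \<Rightarrow> real \<Rightarrow> real" where
  "area_element X \<theta> t =
     (let J = jacobian (\<lambda>\<eta>. X \<eta> t) (at \<theta>) in sqrt (det (transpose J ** J)))"

definition stretch_rate :: "(real^'m \<Rightarrow> real \<Rightarrow> real^'n) \<Rightarrow> real^'m \<Rightarrow> real \<Rightarrow> real" where
  "stretch_rate X \<theta> t = 1 / area_element X \<theta> t * deriv (area_element X \<theta>) t"

definition spatial_jacobian :: "(real^'n \<Rightarrow> real \<Rightarrow> real^'n) \<Rightarrow> real^'n \<Rightarrow> real \<Rightarrow> real^'n^'n" where
  "spatial_jacobian V x t = jacobian (\<lambda>y. V y t) (at x)"

definition divergence :: "(real^'n \<Rightarrow> real \<Rightarrow> real^'n) \<Rightarrow> real^'n \<Rightarrow> real \<Rightarrow> real" where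
  "divergence V x t = (\<Sum>i\<in>UNIV. spatial_jacobian V x t $ i $ i)"

end

theory Submission
  imports Defs
begin

text \<open>
  Let \<open>J\<close> be the Jacobian of the patch in the labels and \<open>G = transpose J ** J\<close>, so that the area
  element is the square root of \<open>det G\<close>. Each tangent vector is carried by the linearised flow, hence
  \<open>J' = M J\<close> with \<open>M\<close> the spatial Jacobian of \<open>V\<close>
  (lemma \<open>moving_tangent_has_vector_derivative\<close>). By Jacobi's formula
  (\<open>has_real_derivative_det\<close>) the logarithmic derivative of the area element is half the trace of
  \<open>G\<^sup>-\<^sup>1 G'\<close>, where \<open>G' = transpose J ** (transpose M + M) ** J\<close>. Cyclicity of the trace turns this
  into the trace of \<open>M\<close> against the orthogonal projection onto the tangent space
  \<open>P = J G\<^sup>-\<^sup>1 (transpose J)\<close>, and \<open>P\<close> is the identity minus the projection onto the normal line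
  (\<open>tangent_plus_normal_projection\<close>): the result is the full trace, which is the divergence, minus the
  normal component.

  The analytic point is the equation \<open>J' = M J\<close>. The patch is smooth in the label for each fixed
  time and follows the trajectories of \<open>V\<close> for each fixed label, and from this separate information the
  time derivative of the label derivative has to be found. The lemma \<open>solutions_strict_derivative\<close>
  supplies it: over a short time the difference of two neighbouring trajectories has a first order
  expansion in time whose error is small relative to their initial distance, uniformly in the pair of
  trajectories.
\<close>

section \<open>Differences of neighbouring trajectories\<close>

text \<open>One linear map approximates the spatial increments of \<open>F\<close> at all times near \<open>t\<close> and over a whole ball of
  base points, which is what comparing two nearby trajectories needs. It comes from the mean value
  inequality, because the spatial partial derivative is continuous jointly in space and time.\<close>

lemma C1_partial_strict_derivative:
  fixes F :: "'a::euclidean_space \<times> real \<Rightarrow> 'b::real_normed_vector"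
  assumes C1: "Ck_on (Suc 0) UNIV F" and "0 < e"
  shows "\<exists>r>0. \<forall>y\<in>ball x0 r. \<forall>z\<in>ball x0 r. \<forall>s. \<bar>s - t\<bar> < r \<longrightarrow>
    norm (F (y, s) - F (z, s) - frechet_derivative F (at (x0, t)) (y - z, 0)) \<le> e * norm (y - z)"
proof -
  define D where "D p h = frechet_derivative F (at p) (h, 0)" for p h
  have der: "(F has_derivative frechet_derivative F (at p)) (at p)" for p
    using C1 by (cases p) (auto simp: frechet_derivative_works[symmetric])
  have partial: "((\<lambda>y. F (y, s)) has_derivative D (y, s)) (at y)" for y s
  proof -
    have "((\<lambda>y. (y, s)) has_derivative (\<lambda>h. (h, 0))) (at y)"
      by (auto intro!: derivative_eq_intros)
    from diff_chain_at[OF this der] show ?thesis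
      by (simp add: o_def D_def[abs_def])
  qed
  have linD: "linear (D p)" for p
    using partial[of "snd p" "fst p"] has_derivative_linear by auto
  define \<phi> where "\<phi> p = (\<Sum>b\<in>Basis. norm (D p b - D (x0, t) b))" for p
  have contD: "isCont (\<lambda>p. D p h) p" for h p
  proof -
    have "continuous_on UNIV (\<lambda>p. D p h)"
      using C1 by (simp add: D_def)
    then show ?thesis by (cases p) (simp add: continuous_on_eq_continuous_at)
  qed
  have "isCont \<phi> (x0, t)"
    unfolding \<phi>_def by (intro continuous_intros contD)
  moreover have "\<phi> (x0, t) = 0" by (simp add: \<phi>_def)
  ultimately obtain d where d: "d > 0" "\<And>p. dist p (x0, t) < d \<Longrightarrow> dist (\<phi> p) 0 < e"
    using \<open>0 < e\<close> unfolding continuous_at_eps_delta by metis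
  have small: "\<phi> (y, s) \<le> e" if "y \<in> ball x0 (d/2)" "\<bar>s - t\<bar> < d/2" for y s
  proof -
    have "dist (y, s) (x0, t) \<le> dist y x0 + dist s t"
      by (simp add: dist_prod_def sqrt_sum_squares_le_sum)
    also have "\<dots> < d" using that by (simp add: dist_commute dist_real_def)
    finally show ?thesis using d(2)[of "(y, s)"] by simp
  qed
  have bound: "norm (D p h - D (x0, t) h) \<le> norm h * \<phi> p" for p h
  proof -
    let ?E = "\<lambda>h. D p h - D (x0, t) h"
    have lin: "linear ?E"
      by (intro linear_compose_sub linD)
    have "?E h = ?E (\<Sum>b\<in>Basis. (h \<bullet> b) *\<^sub>R b)"
      by (simp only: euclidean_representation)
    also have "\<dots> = (\<Sum>b\<in>Basis. (h \<bullet> b) *\<^sub>R ?E b)"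
      by (simp only: linear_sum[OF lin] linear_scale[OF lin])
    also have "norm \<dots> \<le> (\<Sum>b\<in>Basis. norm h * norm (D p b - D (x0, t) b))"
      by (rule sum_norm_le) (simp add: Basis_le_norm mult_right_mono)
    finally show ?thesis by (simp add: \<phi>_def sum_distrib_left)
  qed
  have "norm (F (y, s) - F (z, s) - D (x0, t) (y - z)) \<le> e * norm (y - z)"
    if "y \<in> ball x0 (d/2)" "z \<in> ball x0 (d/2)" "\<bar>s - t\<bar> < d/2" for y z s
  proof -
    let ?f = "\<lambda>y. F (y, s) - D (x0, t) y"
    have blin: "bounded_linear (D (x0, t))" using linD by (simp add: linear_conv_bounded_linear)
    have "norm (?f y - ?f z) \<le> e * norm (y - z)"
    proof (rule differentiable_bound[where S = "ball x0 (d/2)"])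
      fix u assume u: "u \<in> ball x0 (d/2)"
      show "(?f has_derivative (\<lambda>h. D (u, s) h - D (x0, t) h)) (at u within ball x0 (d/2))"
        by (intro has_derivative_diff has_derivative_at_withinI[OF partial]
            bounded_linear_imp_has_derivative blin)
      show "onorm (\<lambda>h. D (u, s) h - D (x0, t) h) \<le> e"
      proof (rule onorm_le)
        fix h
        show "norm (D (u, s) h - D (x0, t) h) \<le> e * norm h"
          using bound[of "(u, s)" h] mult_left_mono[OF small[OF u that(3)], of "norm h"]
          by (simp add: mult.commute)
      qed
    qed (use that in auto)
    moreover have "?f y - ?f z = F (y, s) - F (z, s) - D (x0, t) (y - z)"
      by (simp add: linear_diff[OF linD])
    ultimately show ?thesis by simp
  qed
  then show ?thesis
    using \<open>d > 0\<close> by (intro exI[of _ "d/2"]) (auto simp: D_def)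
qed

text \<open>Having \<open>\<xi>\<close> strictly closer to the centre than \<open>s\<close> is what makes the exit time argument below work:
  before the first exit the trajectory is still in the ball.\<close>

lemma mean_value_from_centre:
  fixes f :: "real \<Rightarrow> 'a::real_inner"
  assumes "\<And>u. u \<in> cball t \<delta> \<Longrightarrow> (f has_vector_derivative f' u) (at u)"
    and s: "s \<in> cball t \<delta>" "s \<noteq> t"
  obtains \<xi> where "dist t \<xi> < dist t s" "norm (f s - f t) \<le> \<bar>s - t\<bar> * norm (f' \<xi>)"
proof (cases "t < s")
  case True
  have "\<exists>\<xi>\<in>{t<..<s}. norm (f s - f t) \<le> norm ((s - t) *\<^sub>R f' \<xi>)"
    by (rule mvt_general[OF True, where f' = "\<lambda>\<xi> h. h *\<^sub>R f' \<xi>"])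
       (use s True in \<open>auto simp: dist_real_def simp flip: has_vector_derivative_def
         intro!: assms(1) continuous_at_imp_continuous_on has_vector_derivative_continuous\<close>)
  then obtain \<xi> where "t < \<xi>" "\<xi> < s" "norm (f s - f t) \<le> norm ((s - t) *\<^sub>R f' \<xi>)"
    by auto
  then show ?thesis using that[of \<xi>] True by (simp add: dist_real_def)
next
  case False
  then have "s < t" using s by simp
  have "\<exists>\<xi>\<in>{s<..<t}. norm (f t - f s) \<le> norm ((t - s) *\<^sub>R f' \<xi>)"
    by (rule mvt_general[OF \<open>s < t\<close>, where f' = "\<lambda>\<xi> h. h *\<^sub>R f' \<xi>"])
       (use s False in \<open>auto simp: dist_real_def simp flip: has_vector_derivative_def
         intro!: assms(1) continuous_at_imp_continuous_on has_vector_derivative_continuous\<close>)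
  then obtain \<xi> where "s < \<xi>" "\<xi> < t" "norm (f t - f s) \<le> norm ((t - s) *\<^sub>R f' \<xi>)"
    by auto
  then show ?thesis using that[of \<xi>] \<open>s < t\<close> by (simp add: dist_real_def norm_minus_commute)
qed

text \<open>The first time of exit, in either time direction, is a point \<open>u\<close> of the compact exit set that is
  closest to \<open>t\<close>. At all times closer to \<open>t\<close> the speed is at most \<open>K\<close>, so the distance travelled until
  \<open>u\<close> is too small for an exit.\<close>

lemma solution_stays_near:
  fixes x :: "real \<Rightarrow> 'a::euclidean_space"
  assumes sol: "\<And>s. s \<in> cball t \<delta> \<Longrightarrow> (x has_vector_derivative V (x s) s) (at s)"
    and bound: "\<And>y s. y \<in> ball x0 r \<Longrightarrow> \<bar>s - t\<bar> \<le> \<delta> \<Longrightarrow> norm (V y s) \<le> K"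
    and start: "dist x0 (x t) < r / 2" and short: "\<delta> * K \<le> r / 2"
    and s: "s \<in> cball t \<delta>"
  shows "x s \<in> ball x0 r"
proof (rule ccontr)
  define E where "E = {u \<in> cball t \<delta>. r \<le> dist x0 (x u)}"
  assume "x s \<notin> ball x0 r"
  then have "E \<noteq> {}" using s by (auto simp: E_def)
  have "continuous_on (cball t \<delta>) x"
    using sol by (intro continuous_at_imp_continuous_on ballI has_vector_derivative_continuous)
  then have "closed E"
    unfolding E_def by (intro continuous_on_closed_Collect_le continuous_intros) auto
  then obtain u where u: "u \<in> E" "\<And>v. v \<in> E \<Longrightarrow> dist t u \<le> dist t v"
    using distance_attains_inf[OF _ \<open>E \<noteq> {}\<close>] by blast
  have "u \<noteq> t" "u \<in> cball t \<delta>"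
    using u(1) start zero_le_dist[of x0 "x t"] by (auto simp: E_def simp del: zero_le_dist)
  then obtain \<xi> where \<xi>: "dist t \<xi> < dist t u" "norm (x u - x t) \<le> \<bar>u - t\<bar> * norm (V (x \<xi>) \<xi>)"
    using mean_value_from_centre[OF sol] by blast
  have "\<xi> \<notin> E" using u(2) \<xi>(1) by force
  moreover have "\<xi> \<in> cball t \<delta>" using \<xi>(1) \<open>u \<in> cball t \<delta>\<close> by simp
  ultimately have "norm (V (x \<xi>) \<xi>) \<le> K"
    by (intro bound) (auto simp: E_def dist_real_def)
  moreover have "\<bar>u - t\<bar> \<le> \<delta>" using \<open>u \<in> cball t \<delta>\<close> by (simp add: dist_real_def)
  ultimately have "\<bar>u - t\<bar> * norm (V (x \<xi>) \<xi>) \<le> \<delta> * K"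
    by (intro mult_mono) auto
  then have "dist (x t) (x u) \<le> r / 2"
    using \<xi>(2) short by (simp add: dist_norm norm_minus_commute)
  then have "dist x0 (x u) < r"
    using start dist_triangle[of x0 "x u" "x t"] by linarith
  then show False using u(1) by (simp add: E_def)
qed

text \<open>The difference \<open>w\<close> of two trajectories satisfies \<open>w' = M w\<close> up to an error \<open>e/3 * |w|\<close>, so that
  \<open>|w'| \<le> L |w|\<close> with \<open>L = B + e/3\<close>, where \<open>B\<close> bounds \<open>M\<close>. On a time interval with \<open>\<delta> L \<le> 1/2\<close> the maximum of \<open>|w|\<close> is
  therefore at most \<open>2 |w t|\<close>, which replaces Gronwall's inequality, and integrating once more gives the
  first order expansion of \<open>w\<close> at \<open>t\<close>. The error is proportional to \<open>|w t|\<close>; this uniformity is what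
  survives division by a vanishing initial separation.\<close>

lemma solutions_strict_derivative:
  fixes V :: "'a::euclidean_space \<Rightarrow> real \<Rightarrow> 'a"
  assumes "bounded_linear M"
    and strict: "\<And>e. 0 < e \<Longrightarrow> \<exists>r>0. \<forall>y\<in>ball x0 r. \<forall>z\<in>ball x0 r. \<forall>s. \<bar>s - t\<bar> < r \<longrightarrow>
      norm (V y s - V z s - M (y - z)) \<le> e * norm (y - z)"
    and cont: "isCont (\<lambda>(y, s). V y s) (x0, t)"
    and T: "open T" "t \<in> T" and "0 < e"
  shows "\<exists>\<delta>>0. cball t \<delta> \<subseteq> T \<and> (\<forall>x y.
    (\<forall>s\<in>T. (x has_vector_derivative V (x s) s) (at s)) \<longrightarrow>
    (\<forall>s\<in>T. (y has_vector_derivative V (y s) s) (at s)) \<longrightarrow>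
    dist x0 (x t) < \<delta> \<longrightarrow> dist x0 (y t) < \<delta> \<longrightarrow>
    (\<forall>s\<in>cball t \<delta>. norm ((y s - x s) - (y t - x t) - (s - t) *\<^sub>R M (y t - x t))
        \<le> e * \<bar>s - t\<bar> * norm (y t - x t)))"
proof -
  obtain B where B: "B > 0" "\<And>h. norm (M h) \<le> norm h * B"
    using bounded_linear.pos_bounded[OF \<open>bounded_linear M\<close>] by blast
  obtain r1 where r1: "r1 > 0"
    "\<And>y z s. y \<in> ball x0 r1 \<Longrightarrow> z \<in> ball x0 r1 \<Longrightarrow> \<bar>s - t\<bar> < r1 \<Longrightarrow>
      norm (V y s - V z s - M (y - z)) \<le> e / 3 * norm (y - z)"
    using strict[of "e / 3"] \<open>0 < e\<close> by auto
  define K where "K = norm (V x0 t) + 1"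
  have "K > 0" by (simp add: K_def add_nonneg_pos)
  obtain d where d: "d > 0" "\<And>p. dist p (x0, t) < d \<Longrightarrow> dist ((\<lambda>(y, s). V y s) p) (V x0 t) < 1"
    using cont unfolding continuous_at_eps_delta by (auto dest!: spec[of _ "1::real"])
  define r where "r = min r1 (d / 2)"
  have "r > 0" using r1 d by (simp add: r_def)
  have K: "norm (V y s) \<le> K" if "y \<in> ball x0 r" "\<bar>s - t\<bar> < r" for y s
  proof -
    have "dist (y, s) (x0, t) \<le> dist y x0 + dist s t"
      by (simp add: dist_prod_def sqrt_sum_squares_le_sum)
    also have "\<dots> < d" using that by (simp add: dist_commute dist_real_def r_def)
    finally have "norm (V y s - V x0 t) < 1"
      using d(2)[of "(y, s)"] by (simp add: dist_norm)
    then show ?thesis using norm_triangle_sub[of "V y s" "V x0 t"] by (simp add: K_def)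
  qed
  define L where "L = B + e / 3"
  have "L > 0" using B \<open>0 < e\<close> by (simp add: L_def)
  obtain \<tau> where \<tau>: "\<tau> > 0" "cball t \<tau> \<subseteq> T"
    using T open_contains_cball by blast
  \<comment> \<open>In order: solutions exist; the estimate on \<open>V\<close> applies; no exit from the ball; \<open>|w|\<close> at most
    doubles; \<open>M (w u - w t)\<close> contributes at most \<open>e/3 * |w t|\<close>.\<close>
  define \<delta> where "\<delta> = Min {\<tau>, r / 2, r / (2 * K), 1 / (2 * L), e / (6 * B * L)}"
  have \<delta>: "\<delta> > 0" "\<delta> \<le> r / 2" "\<delta> \<le> r / (2 * K)" "\<delta> \<le> 1 / (2 * L)" "\<delta> \<le> e / (6 * B * L)"
    using \<tau>(1) \<open>r > 0\<close> \<open>K > 0\<close> \<open>L > 0\<close> B \<open>0 < e\<close> by (auto simp: \<delta>_def)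
  have "\<delta> \<le> \<tau>" by (simp add: \<delta>_def)
  then have subT: "cball t \<delta> \<subseteq> T" using \<tau>(2) by auto
  have \<delta>': "\<delta> * K \<le> r / 2" "\<delta> * L \<le> 1 / 2" "B * (\<delta> * L) * 2 \<le> e / 3"
    using \<delta>(3-5) \<open>K > 0\<close> \<open>L > 0\<close> B(1) by (simp_all add: field_simps)
  show ?thesis
  proof (intro exI[of _ \<delta>] conjI allI impI ballI \<open>\<delta> > 0\<close> subT)
    fix x y s
    assume x: "\<forall>s\<in>T. (x has_vector_derivative V (x s) s) (at s)"
      and y: "\<forall>s\<in>T. (y has_vector_derivative V (y s) s) (at s)"
      and x0: "dist x0 (x t) < \<delta>" and y0: "dist x0 (y t) < \<delta>" and s: "s \<in> cball t \<delta>"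
    have short: "\<bar>u - t\<bar> < r" if "u \<in> cball t \<delta>" for u
      using that \<delta>(2) \<open>r > 0\<close> by (simp add: dist_real_def abs_minus_commute)
    have near: "z u \<in> ball x0 r"
      if z: "\<forall>s\<in>T. (z has_vector_derivative V (z s) s) (at s)" "dist x0 (z t) < \<delta>"
        and u: "u \<in> cball t \<delta>" for z u
    proof (rule solution_stays_near[where \<delta> = \<delta> and K = K and V = V and x = z])
      show "(z has_vector_derivative V (z s) s) (at s)" if "s \<in> cball t \<delta>" for s
        using z(1) that subT by blast
      show "norm (V y s) \<le> K" if "y \<in> ball x0 r" "\<bar>s - t\<bar> \<le> \<delta>" for y s
        using K[OF that(1), of s] that(2) \<delta>(2) \<open>r > 0\<close> by linarith
      show "dist x0 (z t) < r / 2" using z(2) \<delta>(2) by linarith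
    qed (fact \<delta>'(1), fact u)
    define w where "w u = y u - x u" for u
    define w' where "w' u = V (y u) u - V (x u) u" for u
    have w: "(w has_vector_derivative w' u) (at u)" if "u \<in> cball t \<delta>" for u
      unfolding w_def w'_def using x y that subT by (intro has_vector_derivative_diff) blast+
    have lin: "norm (w' u - M (w u)) \<le> e / 3 * norm (w u)" if "u \<in> cball t \<delta>" for u
      unfolding w_def w'_def
      using near[OF x x0 that] near[OF y y0 that] short[OF that]
      by (intro r1(2)) (simp_all add: r_def)
    have w'_le: "norm (w' u) \<le> L * norm (w u)" if "u \<in> cball t \<delta>" for u
      using norm_triangle_sub[of "w' u" "M (w u)"] lin[OF that] B(2)[of "w u"]
      by (simp add: L_def algebra_simps)
    have contw: "continuous_on (cball t \<delta>) w"
      using w by (intro continuous_at_imp_continuous_on ballI has_vector_derivative_continuous)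
    then obtain m where m: "m \<in> cball t \<delta>" "\<And>u. u \<in> cball t \<delta> \<Longrightarrow> norm (w u) \<le> norm (w m)"
      using continuous_attains_sup[OF compact_cball _ continuous_on_norm[OF contw]] \<open>\<delta> > 0\<close>
      by fastforce
    have move: "norm (w u - w t) \<le> \<delta> * L * norm (w m)" if u: "u \<in> cball t \<delta>" for u
    proof (cases "u = t")
      case True
      then show ?thesis using \<open>\<delta> > 0\<close> \<open>L > 0\<close> by simp
    next
      case False
      then obtain \<xi> where \<xi>: "dist t \<xi> < dist t u" "norm (w u - w t) \<le> \<bar>u - t\<bar> * norm (w' \<xi>)"
        using mean_value_from_centre[OF w u] by blast
      have \<xi>': "\<xi> \<in> cball t \<delta>" using \<xi>(1) u by simp
      have "norm (w' \<xi>) \<le> L * norm (w m)"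
        using w'_le[OF \<xi>'] m(2)[OF \<xi>'] \<open>L > 0\<close> by (meson mult_left_mono order_trans less_imp_le)
      moreover have "\<bar>u - t\<bar> \<le> \<delta>" using u by (simp add: dist_real_def)
      ultimately have "\<bar>u - t\<bar> * norm (w' \<xi>) \<le> \<delta> * (L * norm (w m))"
        by (intro mult_mono) auto
      then show ?thesis using \<xi>(2) by (simp add: mult.assoc)
    qed
    have wm: "norm (w m) \<le> 2 * norm (w t)"
    proof -
      have "norm (w m) \<le> norm (w t) + \<delta> * L * norm (w m)"
        using move[OF m(1)] norm_triangle_sub[of "w m" "w t"] by linarith
      also have "\<delta> * L * norm (w m) \<le> 1 / 2 * norm (w m)"
        using \<delta>'(2) by (rule mult_right_mono) simp
      finally show ?thesis by simp
    qed
    let ?g = "\<lambda>u. w u - (u - t) *\<^sub>R M (w t)"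
    have "norm (?g s - ?g t) \<le> e * \<bar>s - t\<bar> * norm (w t)"
    proof (cases "s = t")
      case False
      have "(?g has_vector_derivative (w' u - M (w t))) (at u)" if "u \<in> cball t \<delta>" for u
        using w[OF that] by (auto intro!: derivative_eq_intros)
      from mean_value_from_centre[OF this s False] obtain \<xi> where
        \<xi>: "dist t \<xi> < dist t s" "norm (?g s - ?g t) \<le> \<bar>s - t\<bar> * norm (w' \<xi> - M (w t))"
        by blast
      have \<xi>': "\<xi> \<in> cball t \<delta>" using \<xi>(1) s by simp
      have "w' \<xi> - M (w t) = (w' \<xi> - M (w \<xi>)) + M (w \<xi> - w t)"
        using \<open>bounded_linear M\<close> by (simp add: linear_simps)
      then have "norm (w' \<xi> - M (w t)) \<le> e / 3 * norm (w \<xi>) + norm (w \<xi> - w t) * B"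
        using norm_triangle_mono[OF lin[OF \<xi>'] B(2)[of "w \<xi> - w t"]] by metis
      also have "e / 3 * norm (w \<xi>) \<le> e / 3 * (2 * norm (w t))"
        using m(2)[OF \<xi>'] wm \<open>0 < e\<close> by (intro mult_left_mono) auto
      also have "norm (w \<xi> - w t) * B \<le> (\<delta> * L * (2 * norm (w t))) * B"
      proof (rule mult_right_mono)
        show "norm (w \<xi> - w t) \<le> \<delta> * L * (2 * norm (w t))"
          using \<open>\<delta> > 0\<close> \<open>L > 0\<close> by (intro order_trans[OF move[OF \<xi>']] mult_left_mono[OF wm]) simp
      qed (use B in simp)
      also have "(\<delta> * L * (2 * norm (w t))) * B = (B * (\<delta> * L) * 2) * norm (w t)"
        by simp
      also have "\<dots> \<le> e / 3 * norm (w t)"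
        using \<delta>'(3) by (rule mult_right_mono) simp
      finally have "norm (w' \<xi> - M (w t)) \<le> e * norm (w t)" by simp
      then have "\<bar>s - t\<bar> * norm (w' \<xi> - M (w t)) \<le> \<bar>s - t\<bar> * (e * norm (w t))"
        by (rule mult_left_mono) simp
      then show ?thesis using \<xi>(2) by (simp add: mult_ac)
    qed simp
    then show "norm ((y s - x s) - (y t - x t) - (s - t) *\<^sub>R M (y t - x t))
        \<le> e * \<bar>s - t\<bar> * norm (y t - x t)"
      by (simp add: w_def algebra_simps)
  qed
qed

lemma directional_quotient_tendsto:
  fixes f :: "'a::real_normed_vector \<Rightarrow> 'b::real_normed_vector"
  assumes "(f has_derivative D) (at a)"
  shows "((\<lambda>h. (f (a + h *\<^sub>R v) - f a) /\<^sub>R h) \<longlongrightarrow> D v) (at_right 0)"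
proof -
  have "((\<lambda>h. a + h *\<^sub>R v) has_vector_derivative v) (at 0)"
    by (auto intro!: derivative_eq_intros)
  then have "((\<lambda>h. f (a + h *\<^sub>R v)) has_vector_derivative D v) (at 0)"
    using vector_derivative_diff_chain_within[of "\<lambda>h. a + h *\<^sub>R v" v 0 UNIV f D]
      has_derivative_at_withinI[OF assms] by (simp add: o_def)
  then have "(\<lambda>h. norm (f (a + h *\<^sub>R v) - f a - h *\<^sub>R D v) / norm h) \<midarrow>0\<rightarrow> 0"
    by (simp add: has_vector_derivative_def has_derivative_at)
  then have "((\<lambda>h. norm ((f (a + h *\<^sub>R v) - f a) /\<^sub>R h - D v)) \<longlongrightarrow> 0) (at 0)"
  proof (rule Lim_transform_eventually)
    show "\<forall>\<^sub>F h in at 0. norm (f (a + h *\<^sub>R v) - f a - h *\<^sub>R D v) / norm h =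
        norm ((f (a + h *\<^sub>R v) - f a) /\<^sub>R h - D v)"
    proof (rule eventually_at_filter[THEN iffD2], rule always_eventually, intro allI impI)
      fix h :: real assume "h \<noteq> 0"
      then have "(f (a + h *\<^sub>R v) - f a) /\<^sub>R h - D v = (f (a + h *\<^sub>R v) - f a - h *\<^sub>R D v) /\<^sub>R h"
        by (simp add: scaleR_diff_right)
      then show "norm (f (a + h *\<^sub>R v) - f a - h *\<^sub>R D v) / norm h =
          norm ((f (a + h *\<^sub>R v) - f a) /\<^sub>R h - D v)"
        by (simp add: divide_inverse mult.commute)
    qed
  qed
  then show ?thesis
    by (auto simp: tendsto_norm_zero_iff LIM_zero_iff intro: tendsto_mono[OF at_le])
qed

section \<open>The linearised flow acts on tangent vectors\<close>

text \<open>The linearised flow equation. Since \<open>X\<close> is smooth in the label only at each fixed time, its two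
  derivatives cannot simply be exchanged. Instead, the expansion in time of the difference of
  two trajectories is applied to the labels \<open>\<theta>\<close> and \<open>\<theta> + h v\<close>; its error is proportional to their
  separation at time \<open>t\<close>, so it may be divided by \<open>h\<close> and the limit \<open>h \<rightarrow> 0\<close> taken at each fixed
  time \<open>s\<close>.\<close>

lemma moving_tangent_has_vector_derivative:
  fixes V :: "real^'n \<Rightarrow> real \<Rightarrow> real^'n" and X :: "real^'m \<Rightarrow> real \<Rightarrow> real^'n"
  assumes V: "smooth_on UNIV (\<lambda>(x, s). V x s)"
    and X: "moving_hypersurface V U T X"
    and \<theta>: "\<theta> \<in> U" and t: "t \<in> T"
  defines "D s \<equiv> frechet_derivative (\<lambda>\<eta>. X \<eta> s) (at \<theta>)"
  shows "((\<lambda>s. D s v) has_vector_derivative spatial_jacobian V (X \<theta> t) t *v D t v) (at t)"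
proof -
  let ?F = "\<lambda>(x, s). V x s" and ?x = "X \<theta> t"
  define M where "M h = frechet_derivative ?F (at (?x, t)) (h, 0)" for h
  have C1: "Ck_on (Suc 0) UNIV ?F" using V by (simp add: smooth_on_def del: Ck_on.simps)
  then have diffF: "?F differentiable at p" for p by (cases p) auto
  have "((\<lambda>y. (y, t)) has_derivative (\<lambda>h. (h, 0))) (at ?x)"
    by (auto intro!: derivative_eq_intros)
  from diff_chain_at[OF this diffF[unfolded frechet_derivative_works]]
  have M: "((\<lambda>y. V y t) has_derivative M) (at ?x)"
    by (simp add: o_def M_def[abs_def])
  then have blM: "bounded_linear M" by (rule has_derivative_bounded_linear)
  have M_eq: "M h = spatial_jacobian V ?x t *v h" for h
    using frechet_derivative_at[OF M] has_derivative_linear[OF M]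
    by (simp add: spatial_jacobian_def jacobian_def matrix_works linear_matrix_vector_mul_eq)
  have D: "((\<lambda>\<eta>. X \<eta> s) has_derivative D s) (at \<theta>)" if "s \<in> T" for s
  proof -
    have "Ck_on (Suc 0) U (\<lambda>\<eta>. X \<eta> s)"
      using X that by (simp add: moving_hypersurface_def immersion_on_def smooth_on_def del: Ck_on.simps)
    then show ?thesis using \<theta> by (simp add: D_def frechet_derivative_works)
  qed
  have sol: "(X \<eta> has_vector_derivative V (X \<eta> s) s) (at s)" if "\<eta> \<in> U" "s \<in> T" for \<eta> s
    using X that by (simp add: moving_hypersurface_def)
  have "open U" "open T" using X by (simp_all add: moving_hypersurface_def)
  have strict: "\<exists>r>0. \<forall>y\<in>ball ?x r. \<forall>z\<in>ball ?x r. \<forall>s. \<bar>s - t\<bar> < r \<longrightarrow>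
      norm (V y s - V z s - M (y - z)) \<le> e * norm (y - z)" if "0 < e" for e
    using C1_partial_strict_derivative[OF C1 that, of ?x t] by (simp only: M_def case_prod_conv)
  have main: "\<exists>\<delta>>0. \<forall>s. dist s t < \<delta> \<longrightarrow>
    norm (D s v - D t v - (s - t) *\<^sub>R M (D t v)) \<le> e * \<bar>s - t\<bar> * norm (D t v)" if "0 < e" for e
  proof -
    have "isCont ?F (?x, t)" by (rule differentiable_imp_continuous_within[OF diffF])
    have "\<exists>\<delta>>0. cball t \<delta> \<subseteq> T \<and> (\<forall>x y.
        (\<forall>s\<in>T. (x has_vector_derivative V (x s) s) (at s)) \<longrightarrow>
        (\<forall>s\<in>T. (y has_vector_derivative V (y s) s) (at s)) \<longrightarrow>
        dist ?x (x t) < \<delta> \<longrightarrow> dist ?x (y t) < \<delta> \<longrightarrow>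
        (\<forall>s\<in>cball t \<delta>. norm ((y s - x s) - (y t - x t) - (s - t) *\<^sub>R M (y t - x t))
          \<le> e * \<bar>s - t\<bar> * norm (y t - x t)))"
      by (rule solutions_strict_derivative) fact+
    then obtain \<delta> where "\<delta> > 0" "cball t \<delta> \<subseteq> T" and all_solutions:
      "\<forall>x y. (\<forall>s\<in>T. (x has_vector_derivative V (x s) s) (at s)) \<longrightarrow>
        (\<forall>s\<in>T. (y has_vector_derivative V (y s) s) (at s)) \<longrightarrow>
        dist ?x (x t) < \<delta> \<longrightarrow> dist ?x (y t) < \<delta> \<longrightarrow>
        (\<forall>s\<in>cball t \<delta>. norm ((y s - x s) - (y t - x t) - (s - t) *\<^sub>R M (y t - x t))
          \<le> e * \<bar>s - t\<bar> * norm (y t - x t))"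
      by (elim exE conjE)
    note \<delta> = all_solutions[rule_format, of "X \<theta>"]
    have "norm (D s v - D t v - (s - t) *\<^sub>R M (D t v)) \<le> e * \<bar>s - t\<bar> * norm (D t v)"
      if s: "dist s t < \<delta>" for s
    proof -
      have s': "s \<in> cball t \<delta>" "s \<in> T"
        using s \<open>cball t \<delta> \<subseteq> T\<close> by (auto simp: dist_commute)
      let ?q = "\<lambda>s h. (X (\<theta> + h *\<^sub>R v) s - X \<theta> s) /\<^sub>R h"
      have q: "((?q s) \<longlongrightarrow> D s v) (at_right 0)" if "s \<in> T" for s
        by (rule directional_quotient_tendsto[OF D[OF that]])
      have line: "((\<lambda>h. \<theta> + h *\<^sub>R v) \<longlongrightarrow> \<theta>) (at_right 0)"
        by (auto intro!: tendsto_eq_intros)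
      then have inU: "\<forall>\<^sub>F h in at_right 0. \<theta> + h *\<^sub>R v \<in> U"
        using \<open>open U\<close> \<theta> by (rule topological_tendstoD)
      have "isCont (\<lambda>\<eta>. X \<eta> t) \<theta>" using D[OF t] by (rule has_derivative_continuous)
      from isCont_tendsto_compose[OF this line]
      have close: "\<forall>\<^sub>F h in at_right 0. dist (X (\<theta> + h *\<^sub>R v) t) ?x < \<delta>"
        using \<open>\<delta> > 0\<close> by (rule tendstoD)
      have ev: "\<forall>\<^sub>F h in at_right 0. norm (?q s h - ?q t h - (s - t) *\<^sub>R M (?q t h)) \<le> e * \<bar>s - t\<bar> * norm (?q t h)"
        using inU close eventually_at_right_less
      proof eventually_elim
        case (elim h)
        let ?y = "X (\<theta> + h *\<^sub>R v)"
        let ?d = "(?y s - X \<theta> s) - (?y t - ?x) - (s - t) *\<^sub>R M (?y t - ?x)"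
        have "norm ?d \<le> e * \<bar>s - t\<bar> * norm (?y t - ?x)"
          using sol \<theta> elim \<open>\<delta> > 0\<close> s' by (intro \<delta>) (auto simp: dist_commute)
        then have "norm ?d / h \<le> e * \<bar>s - t\<bar> * norm (?y t - ?x) / h"
          using elim by (intro divide_right_mono) auto
        moreover have "?q s h - ?q t h - (s - t) *\<^sub>R M (?q t h) = ?d /\<^sub>R h"
          using blM by (simp add: linear_simps scaleR_diff_right mult.commute)
        then have "norm (?q s h - ?q t h - (s - t) *\<^sub>R M (?q t h)) = norm ?d / h"
          using elim by (simp only: norm_scaleR) (simp add: divide_inverse mult.commute)
        moreover have "norm (?q t h) = norm (?y t - ?x) / h"
          using elim by (simp add: divide_inverse mult.commute)
        ultimately show ?case by simp
      qed
      have lim1: "((\<lambda>h. norm (?q s h - ?q t h - (s - t) *\<^sub>R M (?q t h))) \<longlongrightarrow>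
          norm (D s v - D t v - (s - t) *\<^sub>R M (D t v))) (at_right 0)"
        by (intro tendsto_intros q s' t bounded_linear.tendsto[OF blM])
      have lim2: "((\<lambda>h. e * \<bar>s - t\<bar> * norm (?q t h)) \<longlongrightarrow> e * \<bar>s - t\<bar> * norm (D t v)) (at_right 0)"
        by (intro tendsto_intros q t)
      show ?thesis
        by (rule tendsto_le[OF trivial_limit_at_right_real lim2 lim1 ev])
    qed
    then show ?thesis using \<open>\<delta> > 0\<close> by blast
  qed
  show ?thesis
    unfolding has_vector_derivative_def has_derivative_at_alt
  proof (intro conjI allI impI)
    show "bounded_linear (\<lambda>h. h *\<^sub>R (spatial_jacobian V ?x t *v D t v))"
      by (rule bounded_linear_scaleR_left)
    fix e :: real assume "0 < e"
    define e' where "e' = e / (norm (D t v) + 1)"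
    have "e' > 0" using \<open>0 < e\<close> by (simp add: e'_def add_nonneg_pos)
    have "e' * norm (D t v) \<le> e"
      using \<open>0 < e\<close> mult_left_mono[of "norm (D t v)" "norm (D t v) + 1" e]
      by (simp add: e'_def pos_divide_le_eq add_nonneg_pos)
    obtain \<delta> where \<delta>: "\<delta> > 0" "\<And>s. dist s t < \<delta> \<Longrightarrow>
      norm (D s v - D t v - (s - t) *\<^sub>R M (D t v)) \<le> e' * \<bar>s - t\<bar> * norm (D t v)"
      using main[OF \<open>e' > 0\<close>] by blast
    show "\<exists>d>0. \<forall>s. norm (s - t) < d \<longrightarrow> norm (D s v - D t v - (s - t) *\<^sub>R (spatial_jacobian V ?x t *v D t v))
        \<le> e * norm (s - t)"
    proof (intro exI[of _ \<delta>] conjI allI impI \<open>\<delta> > 0\<close>)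
      fix s assume "norm (s - t) < \<delta>"
      then have "norm (D s v - D t v - (s - t) *\<^sub>R M (D t v)) \<le> (e' * norm (D t v)) * \<bar>s - t\<bar>"
        using \<delta>(2)[of s] by (simp add: dist_norm mult_ac)
      also have "\<dots> \<le> e * \<bar>s - t\<bar>"
        using \<open>e' * norm (D t v) \<le> e\<close> by (rule mult_right_mono) simp
      finally show "norm (D s v - D t v - (s - t) *\<^sub>R (spatial_jacobian V ?x t *v D t v)) \<le> e * norm (s - t)"
        by (simp add: M_eq)
    qed
  qed
qed

section \<open>Determinants and the tangential projection\<close>

text \<open>In the permutation expansion only the identity contributes to first order: any other permutation
  moves at least two indices, and every term of the product rule keeps one of these vanishing
  off-diagonal factors.\<close>

lemma has_real_derivative_det_at_mat_1:
  fixes A :: "real \<Rightarrow> real^'n^'n"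
  assumes A: "\<And>i j. ((\<lambda>s. A s $ i $ j) has_real_derivative A' $ i $ j) (at t)"
    and A1: "A t = mat 1"
  shows "((\<lambda>s. det (A s)) has_real_derivative trace A') (at t)"
proof -
  let ?P = "{p. p permutes (UNIV :: 'n set)}"
  define c where "c p = (\<Sum>i\<in>UNIV. A' $ i $ p i * (\<Prod>j\<in>UNIV - {i}. A t $ j $ p j))" for p
  have "((\<lambda>s. det (A s)) has_real_derivative (\<Sum>p\<in>?P. of_int (sign p) * c p)) (at t)"
    unfolding det_def c_def
    by (intro DERIV_sum DERIV_cmult has_field_derivative_prod A)
  moreover have "(\<Sum>p\<in>?P. of_int (sign p) * c p) = (\<Sum>p\<in>{id}. of_int (sign p) * c p)"
  proof (rule sum.mono_neutral_right)
    show "finite ?P" by (simp add: finite_permutations)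
    show "{id} \<subseteq> ?P" by (simp add: permutes_id)
    show "\<forall>p\<in>?P - {id}. of_int (sign p) * c p = 0"
    proof
      fix p assume p: "p \<in> ?P - {id}"
      then obtain a where a: "p a \<noteq> a" by (auto simp: fun_eq_iff)
      have "inj p" using p permutes_inj by auto
      have zero: "(\<Prod>j\<in>UNIV - {i}. A t $ j $ p j) = 0" for i
      proof -
        \<comment> \<open>both \<open>a\<close> and \<open>p a\<close> are moved, and one of them is not \<open>i\<close>\<close>
        obtain b where "b \<noteq> i" "p b \<noteq> b"
          using a injD[OF \<open>inj p\<close>] by metis
        then have "A t $ b $ p b = 0" by (simp add: A1 mat_def)
        then show ?thesis using \<open>b \<noteq> i\<close> by (intro prod_zero) auto
      qed
      then show "of_int (sign p) * c p = 0" by (simp only: c_def zero) simp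
    qed
  qed
  moreover have "c id = trace A'"
    by (simp add: c_def trace_def A1 mat_def)
  ultimately show ?thesis by (simp add: sign_id)
qed

text \<open>Jacobi's formula; multiplication by the inverse at time \<open>t\<close> reduces it to the identity matrix.\<close>

lemma has_real_derivative_det:
  fixes A :: "real \<Rightarrow> real^'n^'n"
  assumes A: "\<And>i j. ((\<lambda>s. A s $ i $ j) has_real_derivative A' $ i $ j) (at t)"
    and B: "B ** A t = mat 1"
  shows "((\<lambda>s. det (A s)) has_real_derivative det (A t) * trace (B ** A')) (at t)"
proof -
  have "((\<lambda>s. det (B ** A s)) has_real_derivative trace (B ** A')) (at t)"
  proof (rule has_real_derivative_det_at_mat_1)
    show "((\<lambda>s. (B ** A s) $ i $ j) has_real_derivative (B ** A') $ i $ j) (at t)" for i j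
      unfolding matrix_matrix_mult_def by (auto intro!: DERIV_sum DERIV_cmult A)
  qed (fact B)
  from DERIV_cmult[OF this, of "det (A t)"] show ?thesis
    using arg_cong[OF B, of det]
    by (simp add: det_mul det_I mult.assoc[symmetric] mult.commute[of "det (A t)"])
qed

text \<open>The segment from the identity to \<open>G\<close> consists of positive definite, hence invertible, matrices, so
  the determinant cannot change sign along it.\<close>

lemma det_pos_if_positive_definite:
  fixes G :: "real^'n^'n"
  assumes pd: "\<And>v. v \<noteq> 0 \<Longrightarrow> 0 < v \<bullet> (G *v v)"
  shows "0 < det G"
proof (rule ccontr)
  assume "\<not> 0 < det G"
  define H where "H u = (1 - u) *\<^sub>R mat 1 + u *\<^sub>R G" for u :: real
  have "continuous_on {0..1} (\<lambda>u. det (H u))"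
    unfolding det_def H_def by (intro continuous_intros)
  moreover have "det (H 0) = 1" "det (H 1) \<le> 0"
    using \<open>\<not> 0 < det G\<close> by (simp_all add: H_def)
  ultimately obtain u where u: "0 \<le> u" "u \<le> 1" "det (H u) = 0"
    using IVT2'[of "\<lambda>u. det (H u)" 1 0 0] by auto
  then obtain v where v: "v \<noteq> 0" "H u *v v = 0"
    by (metis invertible_det_nz invertible_left_inverse matrix_left_invertible_ker)
  have "v \<bullet> (H u *v v) = (1 - u) * (v \<bullet> v) + u * (v \<bullet> (G *v v))"
    by (simp add: H_def matrix_vector_mult_add_rdistrib scaleR_matrix_vector_assoc[symmetric] inner_add_right)
  moreover have "0 < \<dots>"
    using u(1,2) pd[OF v(1)] v(1)
    by (cases "u = 0") (auto intro!: add_nonneg_pos)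
  ultimately show False using v(2) by simp
qed

lemma matrix_add_rdistrib:
  fixes A B :: "'a::semiring_1^'k^'n" and C :: "'a^'m^'k"
  shows "(A + B) ** C = A ** C + B ** C"
  by (simp add: matrix_matrix_mult_def vec_eq_iff distrib_right sum.distrib)

lemma gram_positive:
  fixes J :: "real^'m^'n"
  assumes "inj ((*v) J)" and "v \<noteq> 0"
  shows "0 < v \<bullet> ((transpose J ** J) *v v)"
proof -
  have "J *v v \<noteq> 0"
    using injD[OF assms(1), of v 0] assms(2) by auto
  moreover have "v \<bullet> ((transpose J ** J) *v v) = (J *v v) \<bullet> (J *v v)"
    by (metis dot_lmul_matrix matrix_vector_mul_assoc transpose_matrix_vector vector_transpose_matrix inner_commute)
  ultimately show ?thesis by simp
qed

text \<open>The first summand is the orthogonal projection onto the tangent space \<open>range J\<close>, the second one the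
  projection onto the line of \<open>n\<close>. Their sum fixes \<open>range J\<close> and \<open>n\<close>, which span the whole space
  because the codimension is one.\<close>

lemma tangent_plus_normal_projection:
  fixes J :: "real^'m^'n" and n :: "real^'n"
  assumes card: "CARD('m) = CARD('n) - 1"
    and inj: "inj ((*v) J)"
    and n: "norm n = 1" "\<And>v. n \<bullet> (J *v v) = 0"
    and B: "B ** (transpose J ** J) = mat 1"
  shows "J ** B ** transpose J + (\<chi> i j. n $ i * n $ j) = mat 1"
proof -
  define N :: "real^'n^'n" where "N = (\<chi> i j. n $ i * n $ j)"
  have N: "N *v v = (n \<bullet> v) *\<^sub>R n" for v
    by (simp add: N_def vec_eq_iff matrix_vector_mult_def inner_vec_def sum_distrib_left mult_ac)
  define Q where "Q = J ** B ** transpose J + N"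
  have QJ: "Q *v (J *v v) = J *v v" for v
  proof -
    have "Q *v (J *v v) = (J ** (B ** (transpose J ** J))) *v v + N *v (J *v v)"
      by (simp add: Q_def matrix_vector_mult_add_rdistrib matrix_mul_assoc flip: matrix_vector_mul_assoc)
    then show ?thesis by (simp add: B N n)
  qed
  have Qn: "Q *v n = n"
  proof -
    have "transpose J *v n = 0"
    proof (rule vector_eq_ldot[THEN iffD1], rule allI)
      show "x \<bullet> (transpose J *v n) = x \<bullet> 0" for x
        using n(2)[of x] by (simp add: dot_lmul_matrix[symmetric] inner_commute)
    qed
    moreover have "n \<bullet> n = 1" using n(1) by (simp add: norm_eq_1)
    ultimately show ?thesis
      by (simp add: Q_def matrix_vector_mult_add_rdistrib N flip: matrix_vector_mul_assoc)
  qed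
  have "n \<notin> span (range ((*v) J))"
  proof
    assume "n \<in> span (range ((*v) J))"
    then have "n \<in> range ((*v) J)"
      by (simp add: span_eq_iff[THEN iffD2] linear_subspace_image)
    then have "n \<bullet> n = 0" using n(2) by (metis rangeE)
    then show False using n(1) by auto
  qed
  moreover have "dim (range ((*v) J)) = CARD('m)"
    using dim_image_eq[OF matrix_vector_mul_linear, of J UNIV] inj by simp
  ultimately have "dim (insert n (range ((*v) J))) = CARD('m) + 1"
    by (simp add: dim_insert)
  then have "span (insert n (range ((*v) J))) = UNIV"
    using card by (simp flip: dim_eq_full)
  then have v: "v \<in> span (insert n (range ((*v) J)))" for v
    by simp
  have "Q *v v = id v" for v
  proof (rule linear_eq_on[OF matrix_vector_mul_linear linear_id v])
    show "Q *v b = id b" if "b \<in> insert n (range ((*v) J))" for b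
      using that QJ Qn by (metis id_apply insertE rangeE)
  qed
  then have "Q = mat 1" by (simp add: matrix_eq)
  then show ?thesis by (simp add: Q_def N_def)
qed

text \<open>By cyclicity the trace is that of \<open>transpose M + M\<close> against the tangential projection
  \<open>J ** B ** transpose J\<close>, in which the normal direction is missing from the full trace.\<close>

lemma trace_gram_derivative:
  fixes J :: "real^'m^'n" and n :: "real^'n"
  assumes P: "J ** B ** transpose J + (\<chi> i j. n $ i * n $ j) = mat 1"
  shows "trace (B ** (transpose J ** (transpose M + M) ** J)) = 2 * (trace M - n \<bullet> (M *v n))"
proof -
  define S where "S = transpose M + M"
  have "trace (B ** (transpose J ** S ** J)) = trace ((B ** transpose J) ** (S ** J))"
    by (simp add: matrix_mul_assoc)
  also have "\<dots> = trace (S ** (J ** B ** transpose J))"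
    by (subst trace_mul_sym) (simp add: matrix_mul_assoc)
  also have "\<dots> = trace S - trace (S ** (\<chi> i j. n $ i * n $ j))"
    using arg_cong[OF P, of "\<lambda>A. trace (S ** A)"] by (simp add: matrix_add_ldistrib trace_add)
  also have "trace (S ** (\<chi> i j. n $ i * n $ j)) = n \<bullet> (S *v n)"
    by (simp add: trace_def matrix_matrix_mult_def inner_vec_def matrix_vector_mult_def
        sum_distrib_left mult_ac)
  also have "\<dots> = 2 * (n \<bullet> (M *v n))"
    by (simp add: S_def matrix_vector_mult_add_rdistrib inner_add_right dot_lmul_matrix[symmetric] inner_commute)
  also have "trace S = 2 * trace M"
    by (simp add: S_def trace_add trace_def transpose_def sum_distrib_left)
  finally show ?thesis by (simp add: S_def)
qed

section \<open>The surface stretch rate\<close>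

theorem theoremA1:
  fixes V :: "real^'n \<Rightarrow> real \<Rightarrow> real^'n"
    and X :: "real^'m \<Rightarrow> real \<Rightarrow> real^'n"
    and U :: "(real^'m) set" and T :: "real set"
    and \<theta> :: "real^'m" and t :: real and n :: "real^'n"
  assumes "CARD('n) \<ge> 2"
    and "smooth_on UNIV (\<lambda>(x, s). V x s)"
    and "moving_hypersurface V U T X"
    and "\<theta> \<in> U" and "t \<in> T"
    and "unit_normal X \<theta> t n"
  shows "area_element X \<theta> t > 0 \<and>
    area_element X \<theta> differentiable at t \<and>
    stretch_rate X \<theta> t =
      divergence V (X \<theta> t) t - n \<bullet> (spatial_jacobian V (X \<theta> t) t *v n)"
proof -
  define D where "D s = frechet_derivative (\<lambda>\<eta>. X \<eta> s) (at \<theta>)" for s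
  define J where "J s = jacobian (\<lambda>\<eta>. X \<eta> s) (at \<theta>)" for s
  define M where "M = spatial_jacobian V (X \<theta> t) t"
  define G where "G s = transpose (J s) ** J s" for s
  have imm: "Ck_on (Suc 0) U (\<lambda>\<eta>. X \<eta> t)" "inj (D t)"
    using assms(3-5)
    by (simp_all add: moving_hypersurface_def immersion_on_def smooth_on_def D_def del: Ck_on.simps)
  then have "(\<lambda>\<eta>. X \<eta> t) differentiable at \<theta>" using \<open>\<theta> \<in> U\<close> by simp
  then have "linear (D t)" by (simp add: D_def linear_frechet_derivative)
  then have Jt: "J t *v v = D t v" for v
    by (simp add: J_def D_def jacobian_def matrix_works linear_matrix_vector_mul_eq)
  then have injJ: "inj ((*v) (J t))" using imm(2) by (simp add: inj_on_def)
  have J_entry: "J s $ i $ j = D s (axis j 1) $ i" for s i j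
    by (simp add: J_def D_def jacobian_def matrix_def)
  have J': "((\<lambda>s. J s $ i $ j) has_real_derivative (M ** J t) $ i $ j) (at t)" for i j
  proof -
    have "((\<lambda>s. D s (axis j 1)) has_vector_derivative M *v D t (axis j 1)) (at t)"
      unfolding D_def M_def by (rule moving_tangent_has_vector_derivative[OF assms(2-5)])
    from bounded_linear.has_vector_derivative[OF bounded_linear_vec_nth this]
    have "((\<lambda>s. J s $ i $ j) has_vector_derivative (M *v D t (axis j 1)) $ i) (at t)"
      by (simp add: J_entry)
    moreover have "(M *v D t (axis j 1)) $ i = (M ** J t) $ i $ j"
      by (simp add: matrix_matrix_mult_def matrix_vector_mult_def J_entry)
    ultimately show ?thesis by (simp add: has_real_derivative_iff_has_vector_derivative)
  qed
  define G' where "G' = transpose (J t) ** (transpose M + M) ** J t"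
  have G'_eq: "G' = transpose (M ** J t) ** J t + transpose (J t) ** (M ** J t)"
    by (simp add: G'_def matrix_transpose_mul matrix_add_ldistrib matrix_add_rdistrib matrix_mul_assoc)
  have G': "((\<lambda>s. G s $ i $ j) has_real_derivative G' $ i $ j) (at t)" for i j
  proof -
    have "((\<lambda>s. \<Sum>k\<in>UNIV. J s $ k $ i * J s $ k $ j) has_real_derivative
        (\<Sum>k\<in>UNIV. (M ** J t) $ k $ i * J t $ k $ j + (M ** J t) $ k $ j * J t $ k $ i)) (at t)"
      by (intro DERIV_sum DERIV_mult J')
    moreover have "(transpose A ** C) $ i $ j = (\<Sum>k\<in>UNIV. A $ k $ i * C $ k $ j)"
      for A C :: "real^'m^'n"
      by (simp add: matrix_matrix_mult_def transpose_def)
    ultimately show ?thesis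
      unfolding G'_eq by (simp add: G_def sum.distrib mult.commute)
  qed
  have det_pos: "0 < det (G t)"
    unfolding G_def by (intro det_pos_if_positive_definite gram_positive injJ)
  then obtain B where B: "B ** G t = mat 1"
    by (metis invertible_det_nz invertible_def less_irrefl)
  have n: "norm n = 1" "n \<bullet> (J t *v v) = 0" for v
    using \<open>unit_normal X \<theta> t n\<close>
    by (auto simp: unit_normal_def tangent_space_def orthogonal_def Jt D_def)
  have "CARD('m) = CARD('n) - 1" using assms(3) by (simp add: moving_hypersurface_def)
  from tangent_plus_normal_projection[OF this injJ n B[unfolded G_def]]
  have tr: "trace (B ** G') = 2 * (trace M - n \<bullet> (M *v n))"
    unfolding G'_def by (rule trace_gram_derivative)
  have area: "area_element X \<theta> = (\<lambda>s. sqrt (det (G s)))"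
    by (simp add: fun_eq_iff area_element_def G_def J_def Let_def)
  have "((\<lambda>s. det (G s)) has_real_derivative det (G t) * trace (B ** G')) (at t)"
    using G' B by (rule has_real_derivative_det)
  from DERIV_chain2[OF DERIV_real_sqrt[OF det_pos] this]
  have deriv: "(area_element X \<theta> has_real_derivative
      inverse (sqrt (det (G t))) / 2 * (det (G t) * trace (B ** G'))) (at t)"
    by (simp add: area)
  have "stretch_rate X \<theta> t = trace (B ** G') / 2"
    using det_pos
    by (simp add: stretch_rate_def DERIV_imp_deriv[OF deriv]) (simp add: area field_simps flip: power2_eq_square)
  also have "\<dots> = divergence V (X \<theta> t) t - n \<bullet> (spatial_jacobian V (X \<theta> t) t *v n)"
    unfolding tr by (simp add: divergence_def trace_def M_def)
  finally have "stretch_rate X \<theta> t =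
      divergence V (X \<theta> t) t - n \<bullet> (spatial_jacobian V (X \<theta> t) t *v n)" .
  moreover have "area_element X \<theta> differentiable at t"
    using deriv real_differentiable_def by blast
  moreover have "0 < area_element X \<theta> t" using det_pos by (simp add: area)
  ultimately show ?thesis by blast
qed

end
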